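(* Let $X$ be a compact metric space endowed with a reference Borel probability measure $\mu$, and let $\Lambda$ be a set of continuous self-mappings of $X$, endowed with a topology finer than the $C^0$ topology. Then for Baire generic maps $f\in\Lambda$ we have $$\mathcal{B}_{\Lambda,f}=\mathrm{acc}(\{\hat e_n(f)\}_{n\in\mathbb{N}}).$$
   Context: "Finer" means not necessarily strictly finer. For a compact metric space $Y$, $\mathcal{M}_1(Y)$ is the compact space of Borel probability measures on $Y$ with the Wasserstein metric (weak-$*$ topology); $\mathcal{M}_1(\mathcal{M}_1(X))$ is obtained by iterating. For $f\in\Lambda$ let $e_n^f:X\to\mathcal{M}_1(X)$, $e_n^f(x)=\frac1n\sum_{i=0}^{n-1}\delta_{f^i(x)}$, and $\hat e_n(f)=\hat e_n^f=(e_n^f)_*(\mu)\in\mathcal{M}_1(\mathcal{M}_1(X))$. $\mathrm{acc}(\cdot)$ denotes the set of accumulation points (subsequential limits) of a sequence. A map $f\in\Lambda$ statistically bifurcates toward $\hat\nu\in\mathcal{M}_1(\mathcal{M}_1(X))$ through perturbations in $\Lambda$ if there are a sequence $\{f_k\}_k$ in $\Lambda$ converging to $f$ and natural numbers $n_k\to\infty$ such that $\hat e_{n_k}(f_k)\to\hat\nu$. $\mathcal{B}_{\Lambda,f}$ (also written $B_{\Lambda,f}$) is the set of all $\hat\nu$ toward which $f$ statistically bifurcates through perturbations in $\Lambda$. "For Baire generic $f\in\Lambda$" means for all $f$ in a set containing a countable intersection of open dense subsets of $\Lambda$. *)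

theory Defs
  imports "HOL-Probability.Probability"
begin

definition borel_of :: "'a topology \<Rightarrow> 'a measure" where
  "borel_of T = sigma (topspace T) {U. openin T U}"

lemma borel_of_euclidean: "borel_of euclidean = borel"
  by (simp add: borel_of_def borel_def)

lemma space_borel_of [simp]: "space (borel_of T) = topspace T"
  by (simp add: borel_of_def space_measure_of_conv)

definition prob_measures :: "'a topology \<Rightarrow> 'a measure set" where
  "prob_measures T = {\<nu>. prob_space \<nu> \<and> sets \<nu> = sets (borel_of T)}"

text \<open>
  The weak-* topology on the Borel probability measures of \<open>T\<close>, i.e. the coarsest topology for
  which \<open>\<nu> \<mapsto> \<integral>\<phi> d\<nu>\<close> is continuous for every test function \<open>\<phi>\<close>.
  On a compact space the boundedness requirement on \<open>\<phi>\<close> is automatic, and for a compact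
  metrizable \<open>T\<close> this is the topology of the Wasserstein metric.  The construction takes an
  abstract topology to an abstract topology, so that it can be iterated.
\<close>

definition weak_star :: "'a topology \<Rightarrow> 'a measure topology" where
  "weak_star T = topology_generated_by
     {{\<nu> \<in> prob_measures T. (\<integral>x. \<phi> x \<partial>\<nu>) \<in> U} | \<phi> U.
        continuous_map T euclideanreal \<phi> \<and> bounded (\<phi> ` topspace T) \<and> open U}"

lemma topspace_weak_star [simp]: "topspace (weak_star T) = prob_measures T"
proof -
  have "\<exists>\<phi> U. prob_measures T = {\<nu> \<in> prob_measures T. (\<integral>x. \<phi> x \<partial>\<nu>) \<in> U} \<and>
      continuous_map T euclideanreal \<phi> \<and> bounded (\<phi> ` topspace T) \<and> open (U :: real set)"
    by (rule exI[of _ "\<lambda>_. 0"], rule exI[of _ UNIV]) (auto simp: bounded_def)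
  then show ?thesis
    unfolding weak_star_def topology_generated_by_topspace by blast
qed

text \<open>
  The empirical measure \<open>e\<^sub>n\<^sup>f(x) = (1/n) \<Sum>\<^bsub>i<n\<^esub> \<delta>\<^bsub>f\<^sup>i(x)\<^esub>\<close>.  It is meaningful for \<open>n \<ge> 1\<close> only
  (it is the null measure for \<open>n = 0\<close>); below it enters only through limits as \<open>n\<close> tends to infinity.
\<close>

definition empirical :: "nat \<Rightarrow> ('a::topological_space \<Rightarrow> 'a) \<Rightarrow> 'a \<Rightarrow> 'a measure" where
  "empirical n f x = measure_of UNIV (sets borel)
     (\<lambda>A. ennreal (1 / real n) * (\<Sum>i<n. emeasure (return borel ((f ^^ i) x)) A))"

lemma emeasure_empirical:
  assumes "A \<in> sets borel"
  shows "emeasure (empirical n f x) A =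
    ennreal (1 / real n) * (\<Sum>i<n. emeasure (return borel ((f ^^ i) x)) A)"
proof (rule emeasure_measure_of[OF empirical_def])
  show "countably_additive (sets (empirical n f x))
     (\<lambda>A. ennreal (1 / real n) * (\<Sum>i<n. emeasure (return borel ((f ^^ i) x)) A))"
  proof (rule countably_additiveI)
    fix B :: "nat \<Rightarrow> 'a set"
    assume B: "range B \<subseteq> sets (empirical n f x)" "disjoint_family B"
    then have "range B \<subseteq> sets borel"
      by (simp add: empirical_def sigma_algebra.sigma_sets_eq sets.sigma_algebra_axioms[of borel, simplified])
    then have *: "(\<Sum>k. emeasure (return borel ((f ^^ i) x)) (B k)) =
        emeasure (return borel ((f ^^ i) x)) (\<Union>k. B k)" for i
      using B(2) by (intro suminf_emeasure) auto
    have "(\<Sum>k. \<Sum>i<n. emeasure (return borel ((f ^^ i) x)) (B k)) =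
        (\<Sum>i<n. emeasure (return borel ((f ^^ i) x)) (\<Union>k. B k))"
      by (subst suminf_sum) (auto simp: *)
    then show "(\<Sum>k. ennreal (1 / real n) * (\<Sum>i<n. emeasure (return borel ((f ^^ i) x)) (B k))) =
        ennreal (1 / real n) * (\<Sum>i<n. emeasure (return borel ((f ^^ i) x)) (\<Union>k. B k))"
      by simp
  qed
qed (use assms in \<open>auto simp: positive_def empirical_def sigma_algebra.sigma_sets_eq
       sets.sigma_algebra_axioms[of borel, simplified]\<close>)

lemma empirical_in_prob_measures:
  assumes "n \<ge> 1"
  shows "empirical n f x \<in> prob_measures euclidean"
proof -
  have "(\<Sum>i<n. emeasure (return borel ((f ^^ i) x)) UNIV) = ennreal (real n)"
    by (simp add: emeasure_return ennreal_of_nat_eq_real_of_nat)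
  then have "emeasure (empirical n f x) UNIV = 1"
    using assms by (simp add: emeasure_empirical ennreal_mult[symmetric])
  moreover have "sets (empirical n f x) = sets borel" "space (empirical n f x) = UNIV"
    by (simp_all add: empirical_def sigma_algebra.sigma_sets_eq space_measure_of_conv
        sets.sigma_algebra_axioms[of borel, simplified])
  ultimately show ?thesis
    by (auto simp: prob_measures_def borel_of_euclidean intro!: prob_spaceI)
qed

definition empirical_law :: "'a::topological_space measure \<Rightarrow> nat \<Rightarrow> ('a \<Rightarrow> 'a) \<Rightarrow> 'a measure measure" where
  "empirical_law \<mu> n f = distr \<mu> (borel_of (weak_star euclidean)) (empirical n f)"

definition acc :: "'b topology \<Rightarrow> (nat \<Rightarrow> 'b) \<Rightarrow> 'b set" where
  "acc T s = {l. \<exists>r. strict_mono r \<and> limitin T (s \<circ> r) l sequentially}"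

text \<open>
  A family of maps with its topology is given by \<open>L\<close>; its underlying set is \<open>topspace L\<close>.
  On a compact metric space the type of bounded continuous maps consists of all continuous
  maps, and its metric is the \<open>C\<^sup>0\<close> (uniform) metric.
\<close>

definition bifurcates_toward ::
    "('a::metric_space \<Rightarrow>\<^sub>C 'a) topology \<Rightarrow> 'a measure \<Rightarrow> ('a \<Rightarrow>\<^sub>C 'a) \<Rightarrow> 'a measure measure \<Rightarrow> bool" where
  "bifurcates_toward L \<mu> f \<nu> \<longleftrightarrow>
     (\<exists>(g :: nat \<Rightarrow> 'a \<Rightarrow>\<^sub>C 'a) (n :: nat \<Rightarrow> nat).
        (\<forall>k. g k \<in> topspace L) \<and> limitin L g f sequentially \<and> filterlim n at_top sequentially \<and>
        limitin (weak_star (weak_star euclidean))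
          (\<lambda>k. empirical_law \<mu> (n k) (apply_bcontfun (g k))) \<nu> sequentially)"

definition bifurcation_set ::
    "('a::metric_space \<Rightarrow>\<^sub>C 'a) topology \<Rightarrow> 'a measure \<Rightarrow> ('a \<Rightarrow>\<^sub>C 'a) \<Rightarrow> 'a measure measure set" where
  "bifurcation_set L \<mu> f = {\<nu>. bifurcates_toward L \<mu> f \<nu>}"

definition baire_generic :: "'b topology \<Rightarrow> ('b \<Rightarrow> bool) \<Rightarrow> bool" where
  "baire_generic L P \<longleftrightarrow>
     (\<exists>\<G>. countable \<G> \<and> (\<forall>U\<in>\<G>. openin L U \<and> L closure_of U = topspace L) \<and>
        (\<forall>f \<in> topspace L \<inter> \<Inter>\<G>. P f))"

end

theory Submission imports Defs begin

text \<open>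
  Let \<open>Y = weak_star (weak_star euclidean)\<close>, the space in which the laws of empirical measures live,
  and suppose that it has a countable base.  For a basic open set \<open>V\<close> and \<open>N\<close>, let \<open>R\<^bsub>V,N\<^esub>\<close> be the
  set of maps \<open>f\<close> whose law \<open>empirical_law \<mu> n f\<close> visits \<open>V\<close> at some time \<open>n > N\<close>.  At a fixed time
  the law depends continuously on \<open>f\<close>, so \<open>R\<^bsub>V,N\<^esub>\<close> is open, and together with its exterior it forms a
  dense open set.  Let \<open>f\<close> lie in all of these countably many sets.  If \<open>f\<close> bifurcates toward \<open>l\<close>
  and \<open>l \<in> V\<close>, then \<open>f\<close> is a limit of maps in \<open>R\<^bsub>V,N\<^esub>\<close>, hence not in the exterior, hence in
  \<open>R\<^bsub>V,N\<^esub>\<close> itself.  So the laws of the single map \<open>f\<close> visit every neighbourhood of \<open>l\<close> at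
  arbitrarily large times, and \<open>l\<close> is the limit of a subsequence.  The other inclusion holds for
  every \<open>f\<close>, by perturbing \<open>f\<close> to itself.  This is \<open>generic_limits_eq_acc\<close>; it remains to supply
  the continuity and the countable base.

  Continuity (\<open>continuous_map_empirical_law\<close>): uniform convergence of maps gives convergence of each
  finite orbit segment, hence pointwise convergence of the empirical measures, and dominated
  convergence carries this over to the laws.

  Countable base (\<open>cozero_base_weak_star\<close>): the property that passes from a space \<open>T\<close> to
  \<open>weak_star T\<close> is the existence of a countable family of continuous real functions whose sets of
  positivity form a base.  It makes every continuous function with values in \<open>[0, 1]\<close> the
  increasing limit of functions from a fixed countable family \<open>F\<close>, so by convergence of the integrals
  the open half spaces \<open>{\<nu>. q < \<integral>\<psi> d\<nu>}\<close> with \<open>\<psi> \<in> F\<close> and rational \<open>q\<close> form a subbase of \<open>weak_star T\<close>;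
  finite minima of the functions \<open>\<nu> \<mapsto> \<integral>\<psi> d\<nu> - q\<close> are the family sought on \<open>weak_star T\<close>.
  Two such passages lead from the compact metric space of points to \<open>Y\<close>.
\<close>

section \<open>Integration on spaces of probability measures\<close>


lemma openin_sets_borel_of: "openin T U \<Longrightarrow> U \<in> sets (borel_of T)"
  unfolding borel_of_def by (subst sets_measure_of) (auto dest: openin_subset)

lemma prob_measuresD:
  assumes "\<nu> \<in> prob_measures T"
  shows "prob_space \<nu>" "sets \<nu> = sets (borel_of T)" "space \<nu> = topspace T"
  using assms sets_eq_imp_space_eq[of \<nu> "borel_of T"] by (auto simp: prob_measures_def)

lemma borel_measurable_continuous_map:
  fixes \<phi> :: "'b \<Rightarrow> real"
  assumes "continuous_map T euclideanreal \<phi>" "sets M = sets (borel_of T)"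
  shows "\<phi> \<in> borel_measurable M"
proof (rule borel_measurableI)
  fix S :: "real set" assume "open S"
  then have "openin T {x \<in> topspace T. \<phi> x \<in> S}"
    using assms(1) openin_continuous_map_preimage by fastforce
  moreover have "\<phi> -` S \<inter> space M = {x \<in> topspace T. \<phi> x \<in> S}"
    using sets_eq_imp_space_eq[OF assms(2)] by auto
  ultimately show "\<phi> -` S \<inter> space M \<in> sets M"
    by (simp add: assms(2) openin_sets_borel_of)
qed

lemma integrable_continuous_bounded:
  fixes \<phi> :: "'b \<Rightarrow> real"
  assumes "\<nu> \<in> prob_measures T" "continuous_map T euclideanreal \<phi>" "bounded (\<phi> ` topspace T)"
  shows "integrable \<nu> \<phi>"
proof -
  interpret prob_space \<nu> using assms(1) by (rule prob_measuresD)
  obtain B where "\<And>x. x \<in> topspace T \<Longrightarrow> norm (\<phi> x) \<le> B"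
    using assms(3) by (auto simp: bounded_iff)
  then have "AE x in \<nu>. norm (\<phi> x) \<le> B"
    using prob_measuresD(3)[OF assms(1)] by (auto intro!: AE_I2)
  then show ?thesis
    using borel_measurable_continuous_map[OF assms(2) prob_measuresD(2)[OF assms(1)]]
    by (rule integrable_const_bound)
qed

lemma continuous_map_integral:
  assumes "continuous_map T euclideanreal \<phi>" "bounded (\<phi> ` topspace T)"
  shows "continuous_map (weak_star T) euclideanreal (\<lambda>\<nu>. \<integral>x. \<phi> x \<partial>\<nu>)"
  unfolding continuous_map_def
proof (intro conjI allI impI)
  fix U :: "real set" assume "openin euclidean U"
  then show "openin (weak_star T) {\<nu> \<in> topspace (weak_star T). (\<integral>x. \<phi> x \<partial>\<nu>) \<in> U}"
    using assms unfolding topspace_weak_star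
    by (subst weak_star_def, intro topology_generated_by_Basis) auto
qed auto

lemma continuous_map_into_weak_star:
  assumes "\<And>z. z \<in> topspace Z \<Longrightarrow> h z \<in> prob_measures T"
    and "\<And>\<phi>. continuous_map T euclideanreal \<phi> \<Longrightarrow> bounded (\<phi> ` topspace T) \<Longrightarrow>
           continuous_map Z euclideanreal (\<lambda>z. \<integral>x. \<phi> x \<partial>h z)"
  shows "continuous_map Z (weak_star T) h"
  unfolding weak_star_def
proof (rule continuous_on_generated_topo)
  fix W assume "W \<in> {{\<nu> \<in> prob_measures T. (\<integral>x. \<phi> x \<partial>\<nu>) \<in> U} | \<phi> U.
      continuous_map T euclideanreal \<phi> \<and> bounded (\<phi> ` topspace T) \<and> open U}"
  then obtain \<phi> and U :: "real set" where W: "W = {\<nu> \<in> prob_measures T. (\<integral>x. \<phi> x \<partial>\<nu>) \<in> U}"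
    and \<phi>: "continuous_map T euclideanreal \<phi>" "bounded (\<phi> ` topspace T)" and "open U" by blast
  have "h -` W \<inter> topspace Z = {z \<in> topspace Z. (\<integral>x. \<phi> x \<partial>h z) \<in> U}"
    using assms(1) by (auto simp: W)
  then show "openin Z (h -` W \<inter> topspace Z)"
    using assms(2)[OF \<phi>] \<open>open U\<close> by (simp add: continuous_map_def)
next
  show "h ` topspace Z \<subseteq> \<Union> {{\<nu> \<in> prob_measures T. (\<integral>x. \<phi> x \<partial>\<nu>) \<in> U} | \<phi> U.
      continuous_map T euclideanreal \<phi> \<and> bounded (\<phi> ` topspace T) \<and> open U}"
    using assms(1) topspace_weak_star[of T]
    unfolding weak_star_def topology_generated_by_topspace by blast
qed

section \<open>Countable bases of sets of positivity\<close>

text \<open>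
  A base of cozero sets, recorded through the functions themselves: the functions, rather than only
  the sets, are what the passage to measures consumes and produces.
\<close>

definition cozero_base :: "'b topology \<Rightarrow> ('b \<Rightarrow> real) set \<Rightarrow> bool" where
  "cozero_base T C \<longleftrightarrow>
     (\<forall>g\<in>C. continuous_map T euclideanreal g) \<and>
     (\<forall>U x. openin T U \<longrightarrow> x \<in> U \<longrightarrow> (\<exists>g\<in>C. g x > 0 \<and> {y \<in> topspace T. g y > 0} \<subseteq> U))"

lemma cozero_base_continuous: "cozero_base T C \<Longrightarrow> g \<in> C \<Longrightarrow> continuous_map T euclideanreal g"
  by (auto simp: cozero_base_def)

lemma cozero_baseE:
  assumes "cozero_base T C" "openin T U" "x \<in> U"
  obtains g where "g \<in> C" "g x > 0" "{y \<in> topspace T. g y > 0} \<subseteq> U"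
  using assms unfolding cozero_base_def by meson

lemma cozero_base_imp_second_countable:
  assumes "cozero_base T C" "countable C"
  shows "second_countable T"
  unfolding second_countable_def
proof (intro exI conjI ballI allI impI)
  let ?B = "(\<lambda>g. {y \<in> topspace T. g y > 0}) ` C"
  show "countable ?B" using assms(2) by simp
  show "openin T V" if "V \<in> ?B" for V
  proof -
    obtain g where g: "g \<in> C" and V: "V = {y \<in> topspace T. g y > 0}"
      using \<open>V \<in> ?B\<close> by blast
    have "openin T {y \<in> topspace T. g y \<in> {0<..}}"
      using cozero_base_continuous[OF assms(1) g] by (rule openin_continuous_map_preimage) simp
    then show ?thesis by (simp add: V)
  qed
  fix U x assume "openin T U \<and> x \<in> U"
  then have U: "openin T U" "x \<in> U" by auto
  with assms(1) obtain g where "g \<in> C" "g x > 0" "{y \<in> topspace T. g y > 0} \<subseteq> U" 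
    by (rule cozero_baseE)
  moreover have "x \<in> topspace T" using U openin_subset by blast
  ultimately show "\<exists>V\<in>?B. x \<in> V \<and> V \<subseteq> U" by blast
qed

text \<open>
  The balls of rational radius around a countable dense set are the sets of positivity of
  \<open>x \<mapsto> r - dist x a\<close>; total boundedness provides the dense set.
\<close>

lemma compact_imp_cozero_base:
  assumes "compact (UNIV :: 'a::metric_space set)"
  obtains C :: "('a::metric_space \<Rightarrow> real) set" where "countable C" "cozero_base euclidean C"
proof -
  have "\<exists>k. finite k \<and> (UNIV :: 'a set) \<subseteq> (\<Union>a\<in>k. ball a (1 / real (Suc n)))" for n
  proof -
    have "0 < 1 / real (Suc n)" by simp
    then show ?thesis using assms unfolding compact_eq_totally_bounded by blast
  qed
  then obtain D where D: "\<And>n. finite (D n)" "\<And>n. (UNIV :: 'a set) \<subseteq> (\<Union>a\<in>D n. ball a (1 / real (Suc n)))"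
    by metis
  define C where "C = (\<lambda>(a, r) x. r - dist x a) ` ((\<Union>n. D n) \<times> \<rat>)"
  have "countable C"
    unfolding C_def
    by (intro countable_image countable_SIGMA countable_UN countable_rat countable_finite D(1)
        countableI_type)
  moreover have "cozero_base euclidean C"
    unfolding cozero_base_def
  proof (intro conjI allI impI ballI)
    show "continuous_map euclidean euclideanreal g" if "g \<in> C" for g
      using that by (auto simp: C_def intro!: continuous_intros)
    fix U and x :: 'a assume "openin euclidean U" "x \<in> U"
    then obtain e where e: "e > 0" "ball x e \<subseteq> U" by (auto simp: open_contains_ball)
    obtain n where n: "1 / real (Suc n) < e / 2"
      using e(1) by (meson half_gt_zero nat_approx_posE)
    obtain a where a: "a \<in> D n" "dist x a < 1 / real (Suc n)"
      using D(2)[of n] by (metis (no_types, lifting) UN_E UNIV_I dist_commute mem_ball subsetD)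
    obtain r where r: "r \<in> \<rat>" "dist x a < r" "r < e / 2"
      using Rats_dense_in_real[of "dist x a" "e / 2"] less_trans[OF a(2) n] by blast
    show "\<exists>g\<in>C. 0 < g x \<and> {y \<in> topspace euclidean. 0 < g y} \<subseteq> U"
    proof (intro bexI[of _ "\<lambda>x. r - dist x a"] conjI subsetI)
      show "0 < r - dist x a" using r by simp
      have "(a, r) \<in> (\<Union>n. D n) \<times> \<rat>" using a r by blast
      then show "(\<lambda>x. r - dist x a) \<in> C" unfolding C_def by (rule rev_image_eqI) simp
      fix y assume "y \<in> {y \<in> topspace euclidean. 0 < r - dist y a}"
      then have "dist x y < e" using r dist_triangle2[of x y a] by simp
      then show "y \<in> U" using e(2) by auto
    qed
  qed
  ultimately show thesis by (rule that)
qed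

section \<open>Passing to the space of probability measures\<close>

text \<open>
  Finite maxima and minima are indexed by lists, so that countability of the families they generate
  is inherited from countability of the set of lists.  The base value \<open>0\<close> is neutral
  for families of nonnegative functions.
\<close>

definition list_max :: "('b \<Rightarrow> real) list \<Rightarrow> 'b \<Rightarrow> real" where
  "list_max gs x = foldr (\<lambda>g. max (g x)) gs 0"

lemma list_max_simps [simp]:
  "list_max [] x = 0" "list_max (g # gs) x = max (g x) (list_max gs x)"
  by (simp_all add: list_max_def)

text \<open>
  The base value \<open>1\<close> only has to be positive: the minimum is used through its sign.
\<close>

definition list_min :: "('b \<Rightarrow> real) list \<Rightarrow> 'b \<Rightarrow> real" where
  "list_min gs x = foldr (\<lambda>g. min (g x)) gs 1"

lemma list_min_simps [simp]:
  "list_min [] x = 1" "list_min (g # gs) x = min (g x) (list_min gs x)"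
  by (simp_all add: list_min_def)

lemma continuous_map_list_max:
  "(\<And>g. g \<in> set gs \<Longrightarrow> continuous_map T euclideanreal g) \<Longrightarrow> continuous_map T euclideanreal (list_max gs)"
proof (induction gs)
  case (Cons g gs)
  then have "continuous_map T euclideanreal (\<lambda>x. max (g x) (list_max gs x))"
    by (intro continuous_map_real_max) auto
  then show ?case by (simp add: list_max_def[abs_def])
qed (simp add: list_max_def[abs_def])

lemma continuous_map_list_min:
  "(\<And>g. g \<in> set gs \<Longrightarrow> continuous_map T euclideanreal g) \<Longrightarrow> continuous_map T euclideanreal (list_min gs)"
proof (induction gs)
  case (Cons g gs)
  then have "continuous_map T euclideanreal (\<lambda>x. min (g x) (list_min gs x))"
    by (intro continuous_map_real_min) auto
  then show ?case by (simp add: list_min_def[abs_def])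
qed (simp add: list_min_def[abs_def])

lemma list_max_nonneg: "0 \<le> list_max gs x"
  by (induction gs) auto

lemma list_max_le: "0 \<le> b \<Longrightarrow> (\<And>g. g \<in> set gs \<Longrightarrow> g x \<le> b) \<Longrightarrow> list_max gs x \<le> b"
  by (induction gs) auto

lemma list_max_upper: "g \<in> set gs \<Longrightarrow> g x \<le> list_max gs x"
  by (induction gs) (auto simp: max.coboundedI2)

lemma list_min_pos_iff: "0 < list_min gs x \<longleftrightarrow> (\<forall>g\<in>set gs. 0 < g x)"
  by (induction gs) auto


text \<open>
  The weak-* topology is defined by uncountably many test functions; this is what reduces them to
  countably many.  From \<open>g\<close> in the cozero base, the bumps \<open>c * max 0 (min 1 (j * g))\<close> with rational
  \<open>c\<close> rise to \<open>c\<close> times the indicator of a basic open set as \<open>j\<close> grows.  Hence \<open>\<phi>\<close>, being lower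
  semicontinuous, is the pointwise supremum of the countably many bumps below it, and finite maxima
  of these converge to \<open>\<phi>\<close> pointwise, so also in integral.
\<close>

lemma countable_lower_approximation:
  assumes C: "cozero_base T C" "countable C"
  obtains F where "countable F"
    and "\<And>\<psi>. \<psi> \<in> F \<Longrightarrow> continuous_map T euclideanreal \<psi>"
    and "\<And>\<psi> x. \<psi> \<in> F \<Longrightarrow> 0 \<le> \<psi> x \<and> \<psi> x \<le> 1"
    and "\<And>\<phi> \<nu> a. \<lbrakk>continuous_map T euclideanreal \<phi>; \<And>x. x \<in> topspace T \<Longrightarrow> 0 \<le> \<phi> x \<and> \<phi> x \<le> 1;
           \<nu> \<in> prob_measures T; a < (\<integral>x. \<phi> x \<partial>\<nu>)\<rbrakk>
         \<Longrightarrow> \<exists>\<psi>\<in>F. (\<forall>x\<in>topspace T. \<psi> x \<le> \<phi> x) \<and> a < (\<integral>x. \<psi> x \<partial>\<nu>)"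
proof -
  define bump where "bump = (\<lambda>(c :: real, j :: nat, g) (x :: 'a). c * max 0 (min 1 (real j * g x)))"
  define B where "B = bump ` ((\<rat> \<inter> {0..1}) \<times> UNIV \<times> C)"
  have B01: "0 \<le> \<psi> x \<and> \<psi> x \<le> 1" if "\<psi> \<in> B" for \<psi> x
  proof -
    from that obtain c j g where c: "0 \<le> c" "c \<le> 1" and \<psi>: "\<psi> = bump (c, j, g)"
      by (auto simp: B_def)
    show ?thesis using c unfolding \<psi> bump_def by (auto intro!: mult_nonneg_nonneg mult_le_one)
  qed
  have Bcont: "continuous_map T euclideanreal \<psi>" if "\<psi> \<in> B" for \<psi>
  proof -
    from that obtain c j g where "g \<in> C" and \<psi>: "\<psi> = bump (c, j, g)"
      by (auto simp: B_def)
    then show ?thesis using cozero_base_continuous[OF C(1)] unfolding \<psi> bump_def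
      by (auto intro!: continuous_map_real_mult continuous_map_real_max continuous_map_real_min)
  qed
  have "countable B"
    unfolding B_def using C(2)
    by (intro countable_image countable_SIGMA countableI_type) (auto intro: countable_subset[OF _ countable_rat])
  define F where "F = list_max ` lists B"
  have "countable F" unfolding F_def using \<open>countable B\<close> by (intro countable_image countable_lists)
  moreover have Fcont: "continuous_map T euclideanreal \<psi>" if "\<psi> \<in> F" for \<psi>
    using that Bcont by (auto simp: F_def intro!: continuous_map_list_max)
  moreover have F01: "0 \<le> \<psi> x \<and> \<psi> x \<le> 1" if "\<psi> \<in> F" for \<psi> x
    using that B01 by (auto simp: F_def intro!: list_max_nonneg list_max_le)
  moreover have "\<exists>\<psi>\<in>F. (\<forall>x\<in>topspace T. \<psi> x \<le> \<phi> x) \<and> a < (\<integral>x. \<psi> x \<partial>\<nu>)"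
    if \<phi>: "continuous_map T euclideanreal \<phi>" and \<phi>01: "\<And>x. x \<in> topspace T \<Longrightarrow> 0 \<le> \<phi> x \<and> \<phi> x \<le> 1"
      and \<nu>: "\<nu> \<in> prob_measures T" and a: "a < (\<integral>x. \<phi> x \<partial>\<nu>)" for \<phi> \<nu> a
  proof -
    define M where "M = {\<psi> \<in> B. \<forall>x\<in>topspace T. \<psi> x \<le> \<phi> x}"
    \<comment> \<open>Near \<open>x\<close> the function \<open>\<phi>\<close> exceeds some rational \<open>c > b\<close>; a bump of height \<open>c\<close> supported there,
      with \<open>j\<close> so large that it attains \<open>c\<close> at \<open>x\<close>, does it.\<close>
    have M_approx: "\<exists>\<psi>\<in>M. b < \<psi> x" if x: "x \<in> topspace T" and b: "b < \<phi> x" "0 \<le> b" for x b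
    proof -
      obtain c where c: "c \<in> \<rat>" "b < c" "c < \<phi> x" using b(1) Rats_dense_in_real by blast
      have "openin T {y \<in> topspace T. \<phi> y \<in> {c<..}}"
        using \<phi> by (rule openin_continuous_map_preimage) simp
      moreover have "x \<in> {y \<in> topspace T. \<phi> y \<in> {c<..}}" using c x by simp
      ultimately obtain g where g: "g \<in> C" "g x > 0"
        "{y \<in> topspace T. g y > 0} \<subseteq> {y \<in> topspace T. \<phi> y \<in> {c<..}}"
        by (rule cozero_baseE[OF C(1)])
      obtain j where j: "1 < real j * g x" using g(2) reals_Archimedean3 by blast
      have "bump (c, j, g) \<in> B"
        unfolding B_def using c b(2) \<phi>01[OF x] g(1) by auto
      moreover have "bump (c, j, g) y \<le> \<phi> y" if y: "y \<in> topspace T" for y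
      proof (cases "g y > 0")
        case True
        then have "c \<le> \<phi> y" using g(3) y by auto
        moreover have "bump (c, j, g) y \<le> c * 1"
          unfolding bump_def prod.case using c b(2) by (intro mult_left_mono) auto
        ultimately show ?thesis by simp
      next
        case False
        then have "real j * g y \<le> 0" by (simp add: mult_nonneg_nonpos)
        then show ?thesis using \<phi>01[OF y] by (simp add: bump_def)
      qed
      moreover have "b < bump (c, j, g) x" using j c by (simp add: bump_def)
      ultimately show ?thesis unfolding M_def by blast
    qed
    have "(\<lambda>_. 0) \<in> B"
    proof -
      have "C \<noteq> {}" if "x \<in> topspace T" for x
        using that C(1) cozero_baseE openin_topspace by (metis empty_iff)
      moreover have "topspace T \<noteq> {}"
        using prob_measuresD[OF \<nu>] prob_space.not_empty by metis
      ultimately obtain g where "g \<in> C" by blast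
      moreover have "(\<lambda>_. 0) = bump (0, 0, g)" by (auto simp: bump_def)
      ultimately show ?thesis unfolding B_def by auto
    qed
    then have "M \<noteq> {}" using \<phi>01 by (auto simp: M_def)
    have "countable M" using \<open>countable B\<close> by (rule countable_subset[rotated]) (auto simp: M_def)
    define e where "e = from_nat_into M"
    have e: "range e = M" unfolding e_def using \<open>M \<noteq> {}\<close> \<open>countable M\<close> by (rule range_from_nat_into)
    have eM: "e i \<in> M" for i using e by blast
    define s where "s n = list_max (map e [0..<n])" for n
    have sF: "s n \<in> F" for n
      unfolding s_def F_def using eM by (intro imageI) (auto simp: M_def)
    have s_le: "s n x \<le> \<phi> x" if "x \<in> topspace T" for n x
      using eM that \<phi>01[OF that] unfolding s_def by (intro list_max_le) (auto simp: M_def)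
    have lim: "(\<lambda>n. s n x) \<longlonglongrightarrow> \<phi> x" if x: "x \<in> topspace T" for x
    proof (rule order_tendstoI)
      fix b assume "b < \<phi> x"
      have "\<exists>m. \<forall>n\<ge>m. b < s n x"
      proof (cases "b < 0")
        case True
        then show ?thesis using F01[OF sF] by (meson less_le_trans)
      next
        case False
        then obtain \<psi> where "\<psi> \<in> M" "b < \<psi> x" using M_approx[OF x \<open>b < \<phi> x\<close>] by auto
        then obtain i where i: "b < e i x" using e by blast
        have "e i x \<le> s n x" if "n \<ge> Suc i" for n
          using that unfolding s_def by (intro list_max_upper) auto
        then show ?thesis using i by (meson less_le_trans)
      qed
      then show "eventually (\<lambda>n. b < s n x) sequentially"
        by (simp add: eventually_sequentially)
    next
      fix b assume "\<phi> x < b"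
      then show "eventually (\<lambda>n. s n x < b) sequentially"
        using s_le[OF x] by (auto intro!: always_eventually intro: le_less_trans)
    qed
    interpret prob_space \<nu> using \<nu> by (rule prob_measuresD)
    have "(\<lambda>n. \<integral>x. s n x \<partial>\<nu>) \<longlonglongrightarrow> (\<integral>x. \<phi> x \<partial>\<nu>)"
    proof (rule integral_dominated_convergence[where w = "\<lambda>_. 1"])
      show "\<phi> \<in> borel_measurable \<nu>"
        using \<phi> prob_measuresD(2)[OF \<nu>] by (rule borel_measurable_continuous_map)
      show "s n \<in> borel_measurable \<nu>" for n
        using Fcont[OF sF] prob_measuresD(2)[OF \<nu>] by (rule borel_measurable_continuous_map)
      show "AE x in \<nu>. (\<lambda>n. s n x) \<longlonglongrightarrow> \<phi> x"
        using lim prob_measuresD(3)[OF \<nu>] by (auto intro!: AE_I2)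
      show "AE x in \<nu>. norm (s n x) \<le> 1" for n
        using F01[OF sF] by simp
    qed simp
    then have "eventually (\<lambda>n. a < (\<integral>x. s n x \<partial>\<nu>)) sequentially"
      using a by (rule order_tendstoD)
    then obtain n where "a < (\<integral>x. s n x \<partial>\<nu>)" by (auto simp: eventually_sequentially)
    then show ?thesis using sF s_le by blast
  qed
  ultimately show thesis by (rule that)
qed

text \<open>
  The approximation from below turns a condition \<open>a < \<integral>\<phi> d\<nu>\<close> into a condition
  \<open>q < \<integral>\<psi> d\<nu>\<close> from a countable list that implies it.  Applied to \<open>\<phi>\<close> and \<open>- \<phi>\<close>, this confines
  \<open>\<integral>\<phi> d\<nu>\<close> to any given interval around its value, which handles the subbasic open sets.
\<close>

lemma cozero_base_weak_star:
  assumes C: "cozero_base T C" "countable C"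
  obtains D where "countable D" "cozero_base (weak_star T) D"
proof -
  obtain F where "countable F"
    and Fcont: "\<And>\<psi>. \<psi> \<in> F \<Longrightarrow> continuous_map T euclideanreal \<psi>"
    and F01: "\<And>\<psi> x. \<psi> \<in> F \<Longrightarrow> 0 \<le> \<psi> x \<and> \<psi> x \<le> 1"
    and F: "\<And>\<phi> \<nu> a. \<lbrakk>continuous_map T euclideanreal \<phi>; \<And>x. x \<in> topspace T \<Longrightarrow> 0 \<le> \<phi> x \<and> \<phi> x \<le> 1;
           \<nu> \<in> prob_measures T; a < (\<integral>x. \<phi> x \<partial>\<nu>)\<rbrakk>
         \<Longrightarrow> \<exists>\<psi>\<in>F. (\<forall>x\<in>topspace T. \<psi> x \<le> \<phi> x) \<and> a < (\<integral>x. \<psi> x \<partial>\<nu>)"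
    using countable_lower_approximation[OF C] by blast
  have Fbdd: "bounded (\<psi> ` topspace T)" if "\<psi> \<in> F" for \<psi>
    using F01[OF that] by (auto simp: bounded_iff intro!: exI[of _ 1])
  define G where "G = (\<lambda>(\<psi>, q :: real) \<nu>. (\<integral>x. \<psi> x \<partial>\<nu>) - q) ` (F \<times> \<rat>)"
  have "countable G"
    unfolding G_def using \<open>countable F\<close> by (intro countable_image countable_SIGMA countable_rat)
  have Gcont: "continuous_map (weak_star T) euclideanreal h" if "h \<in> G" for h
    using that Fcont Fbdd
    by (auto simp: G_def intro!: continuous_map_diff continuous_map_integral)
  have halfspace: "\<exists>h\<in>G. 0 < h \<nu> \<and> (\<forall>\<nu>'\<in>prob_measures T. 0 < h \<nu>' \<longrightarrow> a < (\<integral>x. \<phi> x \<partial>\<nu>'))"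
    if \<phi>: "continuous_map T euclideanreal \<phi>" "bounded (\<phi> ` topspace T)"
      and \<nu>: "\<nu> \<in> prob_measures T" and a: "a < (\<integral>x. \<phi> x \<partial>\<nu>)" for \<phi> \<nu> a
  proof -
    obtain b where b: "b > 0" "\<And>x. x \<in> topspace T \<Longrightarrow> \<bar>\<phi> x\<bar> \<le> b"
      using \<phi>(2) by (auto simp: bounded_pos)
    \<comment> \<open>The approximation is available for values in \<open>[0, 1]\<close>, so rescale affinely.\<close>
    define \<phi>' where "\<phi>' x = (\<phi> x + b) / (2 * b)" for x
    have \<phi>'cont: "continuous_map T euclideanreal \<phi>'"
      unfolding \<phi>'_def using \<phi>(1) b(1) by (intro continuous_map_real_divide continuous_map_add) auto
    have \<phi>'01: "0 \<le> \<phi>' x \<and> \<phi>' x \<le> 1" if "x \<in> topspace T" for x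
      using b(2)[OF that] b(1) by (auto simp: \<phi>'_def abs_le_iff)
    have int: "(\<integral>x. \<phi>' x \<partial>\<nu>') = ((\<integral>x. \<phi> x \<partial>\<nu>') + b) / (2 * b)" if "\<nu>' \<in> prob_measures T" for \<nu>'
    proof -
      interpret prob_space \<nu>' using that by (rule prob_measuresD)
      show ?thesis
        unfolding \<phi>'_def using integrable_continuous_bounded[OF that \<phi>] by (simp add: prob_space)
    qed
    define a' where "a' = (a + b) / (2 * b)"
    have a'_less: "a' < (\<integral>x. \<phi>' x \<partial>\<nu>') \<longleftrightarrow> a < (\<integral>x. \<phi> x \<partial>\<nu>')" if "\<nu>' \<in> prob_measures T" for \<nu>'
      unfolding int[OF that] a'_def using b(1) by (simp add: divide_less_cancel)
    then obtain \<psi> where \<psi>: "\<psi> \<in> F" "\<And>x. x \<in> topspace T \<Longrightarrow> \<psi> x \<le> \<phi>' x" "a' < (\<integral>x. \<psi> x \<partial>\<nu>)"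
      using F[OF \<phi>'cont \<phi>'01 \<nu>] a \<nu> by blast
    obtain q where q: "q \<in> \<rat>" "a' < q" "q < (\<integral>x. \<psi> x \<partial>\<nu>)"
      using \<psi>(3) Rats_dense_in_real by blast
    have "a < (\<integral>x. \<phi> x \<partial>\<nu>')" if \<nu>': "\<nu>' \<in> prob_measures T" and "0 < (\<integral>x. \<psi> x \<partial>\<nu>') - q" for \<nu>'
    proof -
      have "bounded (\<phi>' ` topspace T)"
        using \<phi>'01 by (auto simp: bounded_iff intro!: exI[of _ 1])
      then have "(\<integral>x. \<psi> x \<partial>\<nu>') \<le> (\<integral>x. \<phi>' x \<partial>\<nu>')"
        using \<psi> prob_measuresD(3)[OF \<nu>'] \<nu>' \<phi>'cont Fcont Fbdd
        by (intro integral_mono integrable_continuous_bounded) auto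
      then show ?thesis using that(2) q(2) a'_less[OF \<nu>'] by simp
    qed
    moreover have "(\<lambda>\<nu>. (\<integral>x. \<psi> x \<partial>\<nu>) - q) \<in> G" using \<psi>(1) q(1) by (auto simp: G_def)
    ultimately show ?thesis using q(3) by (intro bexI[of _ "\<lambda>\<nu>. (\<integral>x. \<psi> x \<partial>\<nu>) - q"]) auto
  qed
  define N where "N hs = {\<nu> \<in> prob_measures T. \<forall>h\<in>set hs. 0 < h \<nu>}" for hs :: "('a measure \<Rightarrow> real) list"
  have base: "\<exists>hs\<in>lists G. \<nu> \<in> N hs \<and> N hs \<subseteq> U" if "openin (weak_star T) U" "\<nu> \<in> U" for U \<nu>
  proof -
    have "generate_topology_on {{\<nu> \<in> prob_measures T. (\<integral>x. \<phi> x \<partial>\<nu>) \<in> U} | \<phi> U.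
        continuous_map T euclideanreal \<phi> \<and> bounded (\<phi> ` topspace T) \<and> open U} U"
      using that(1) unfolding weak_star_def by (rule openin_topology_generated_by)
    then show ?thesis using \<open>\<nu> \<in> U\<close>
    proof (induction arbitrary: \<nu>)
      case Empty
      then show ?case by simp
    next
      case (Int U V)
      then obtain hs ks where "hs \<in> lists G" "\<nu> \<in> N hs" "N hs \<subseteq> U" "ks \<in> lists G" "\<nu> \<in> N ks" "N ks \<subseteq> V"
        by (meson IntD1 IntD2)
      then show ?case by (intro bexI[of _ "hs @ ks"]) (auto simp: N_def)
    next
      case (UN K)
      then show ?case by (meson Union_iff Union_upper subset_trans)
    next
      case (Basis W)
      then obtain \<phi> and V :: "real set" where W: "W = {\<nu> \<in> prob_measures T. (\<integral>x. \<phi> x \<partial>\<nu>) \<in> V}"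
        and \<phi>: "continuous_map T euclideanreal \<phi>" "bounded (\<phi> ` topspace T)" and "open V" by blast
      have \<nu>: "\<nu> \<in> prob_measures T" "(\<integral>x. \<phi> x \<partial>\<nu>) \<in> V" using Basis(2) by (auto simp: W)
      obtain e where e: "e > 0" "ball (\<integral>x. \<phi> x \<partial>\<nu>) e \<subseteq> V"
        using \<open>open V\<close> \<nu>(2) by (meson open_contains_ball)
      obtain h where h: "h \<in> G" "0 < h \<nu>"
        "\<And>\<nu>'. \<nu>' \<in> prob_measures T \<Longrightarrow> 0 < h \<nu>' \<Longrightarrow> (\<integral>x. \<phi> x \<partial>\<nu>) - e < (\<integral>x. \<phi> x \<partial>\<nu>')"
        using halfspace[OF \<phi> \<nu>(1), of "(\<integral>x. \<phi> x \<partial>\<nu>) - e"] e(1) by auto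
      have "continuous_map T euclideanreal (\<lambda>x. - \<phi> x)" using \<phi>(1) by (rule continuous_map_minus)
      moreover have "bounded ((\<lambda>x. - \<phi> x) ` topspace T)" using \<phi>(2) by (simp add: bounded_minus_comp)
      ultimately obtain k where k: "k \<in> G" "0 < k \<nu>"
        "\<And>\<nu>'. \<nu>' \<in> prob_measures T \<Longrightarrow> 0 < k \<nu>' \<Longrightarrow> - (\<integral>x. \<phi> x \<partial>\<nu>) - e < - (\<integral>x. \<phi> x \<partial>\<nu>')"
        using halfspace[of "\<lambda>x. - \<phi> x" \<nu> "- (\<integral>x. \<phi> x \<partial>\<nu>) - e"] \<nu>(1) e(1) by auto
      have "N [h, k] \<subseteq> W"
      proof
        fix \<nu>' assume "\<nu>' \<in> N [h, k]"
        then have "\<nu>' \<in> prob_measures T" "0 < h \<nu>'" "0 < k \<nu>'" by (auto simp: N_def)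
        with h(3)[of \<nu>'] k(3)[of \<nu>'] have "(\<integral>x. \<phi> x \<partial>\<nu>') \<in> ball (\<integral>x. \<phi> x \<partial>\<nu>) e"
          by (simp add: dist_real_def abs_less_iff)
        then show "\<nu>' \<in> W" using e(2) \<open>\<nu>' \<in> prob_measures T\<close> by (auto simp: W)
      qed
      then show ?case using h k \<nu>(1) by (intro bexI[of _ "[h, k]"]) (auto simp: N_def)
    qed
  qed
  show thesis
  proof (rule that)
    show "countable (list_min ` lists G)" using \<open>countable G\<close> by (intro countable_image countable_lists)
    show "cozero_base (weak_star T) (list_min ` lists G)"
      unfolding cozero_base_def
    proof (intro conjI ballI allI impI)
      show "continuous_map (weak_star T) euclideanreal g" if "g \<in> list_min ` lists G" for g
        using that Gcont by (auto intro!: continuous_map_list_min)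
      fix U \<nu> assume "openin (weak_star T) U" "\<nu> \<in> U"
      then obtain hs where "hs \<in> lists G" "\<nu> \<in> N hs" "N hs \<subseteq> U" using base by blast
      then show "\<exists>g\<in>list_min ` lists G. 0 < g \<nu> \<and> {\<nu>' \<in> topspace (weak_star T). 0 < g \<nu>'} \<subseteq> U"
        by (intro bexI[of _ "list_min hs"] imageI) (auto simp: N_def list_min_pos_iff)
    qed
  qed
qed

section \<open>Continuous dependence of the empirical law on the map\<close>

text \<open>
  Writing the empirical measure as the image of the uniform distribution on times makes integration
  against it a case of change of variables.
\<close>

lemma empirical_eq_distr:
  assumes "n > 0"
  shows "empirical n f x = distr (uniform_count_measure {..<n}) borel (\<lambda>i. (f ^^ i) x)"
proof (rule measure_eqI)
  show *: "sets (empirical n f x) = sets (distr (uniform_count_measure {..<n}) borel (\<lambda>i. (f ^^ i) x))"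
    using prob_measuresD(2)[OF empirical_in_prob_measures[of n f x]] assms
    by (simp add: borel_of_euclidean)
  fix A assume "A \<in> sets (empirical n f x)"
  then have A: "A \<in> sets borel" using * by simp
  let ?I = "{i \<in> {..<n}. (f ^^ i) x \<in> A}"
  have "(\<Sum>i<n. emeasure (return borel ((f ^^ i) x)) A) = (\<Sum>i<n. if (f ^^ i) x \<in> A then 1 else 0)"
    using A by (intro sum.cong) (auto simp: indicator_def)
  also have "\<dots> = of_nat (card ?I)" by (simp add: sum.If_cases Int_def)
  finally have "emeasure (empirical n f x) A = ennreal (1 / real n) * ennreal (real (card ?I))"
    by (simp add: emeasure_empirical[OF A] ennreal_of_nat_eq_real_of_nat)
  also have "\<dots> = ennreal (card ?I / n)" by (simp add: ennreal_mult[symmetric])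
  also have "\<dots> = emeasure (uniform_count_measure {..<n}) ?I"
    by (subst emeasure_uniform_count_measure) auto
  also have "\<dots> = emeasure (distr (uniform_count_measure {..<n}) borel (\<lambda>i. (f ^^ i) x)) A"
    using A by (subst emeasure_distr)
      (auto simp: uniform_count_measure_def space_point_measure intro!: arg_cong2[where f = emeasure])
  finally show "emeasure (empirical n f x) A = 
      emeasure (distr (uniform_count_measure {..<n}) borel (\<lambda>i. (f ^^ i) x)) A" .
qed

lemma integral_empirical:
  fixes \<phi> :: "'a::topological_space \<Rightarrow> real"
  assumes "n > 0" "\<phi> \<in> borel_measurable borel"
  shows "(\<integral>y. \<phi> y \<partial>empirical n f x) = (\<Sum>i<n. \<phi> ((f ^^ i) x)) / n"
proof -
  have "(\<lambda>i. (f ^^ i) x) \<in> uniform_count_measure {..<n} \<rightarrow>\<^sub>M borel"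
    by (simp add: uniform_count_measure_def)
  then show ?thesis
    using assms by (simp add: empirical_eq_distr integral_distr integral_uniform_count_measure)
qed

text \<open>
  The parameter \<open>z\<close> may move the starting point as well as the map: a moving point makes
  \<open>empirical n f\<close> measurable, and a moving map gives continuity of the law.
\<close>

lemma continuous_map_empirical:
  assumes "n > 0" and "\<And>i. continuous_map Z euclidean (\<lambda>z. (h z ^^ i) (p z))"
  shows "continuous_map Z (weak_star euclidean) (\<lambda>z. empirical n (h z) (p z))"
proof (rule continuous_map_into_weak_star)
  show "empirical n (h z) (p z) \<in> prob_measures euclidean" for z
    using assms(1) by (intro empirical_in_prob_measures) simp
  fix \<phi> :: "'b \<Rightarrow> real" assume \<phi>: "continuous_map euclidean euclideanreal \<phi>"
  have "\<phi> \<in> borel_measurable borel"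
    using \<phi> by (rule borel_measurable_continuous_map) (simp add: borel_of_euclidean)
  moreover have "continuous_map Z euclideanreal (\<lambda>z. (\<Sum>i<n. \<phi> ((h z ^^ i) (p z))) / n)"
    using assms(1) continuous_map_compose[OF assms(2) \<phi>]
    by (intro continuous_map_real_divide continuous_map_sum) (auto simp: o_def)
  ultimately show "continuous_map Z euclideanreal (\<lambda>z. \<integral>y. \<phi> y \<partial>empirical n (h z) (p z))"
    using assms(1) by (simp add: integral_empirical)
qed

lemma continuous_on_iterate_bcontfun:
  "continuous_on UNIV (\<lambda>f :: 'a::metric_space \<Rightarrow>\<^sub>C 'a. (apply_bcontfun f ^^ i) x)"
proof (induction i)
  case (Suc i)
  have "((\<lambda>f. apply_bcontfun f ((apply_bcontfun f ^^ i) x)) \<longlongrightarrow>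
      apply_bcontfun g ((apply_bcontfun g ^^ i) x)) (at g)" for g :: "'a \<Rightarrow>\<^sub>C 'a"
  proof -
    let ?y = "\<lambda>f :: 'a \<Rightarrow>\<^sub>C 'a. (apply_bcontfun f ^^ i) x"
    have "(?y \<longlongrightarrow> ?y g) (at g)" using Suc by (simp add: continuous_on_def)
    then have "((\<lambda>f. apply_bcontfun g (?y f)) \<longlongrightarrow> apply_bcontfun g (?y g)) (at g)"
      using continuous_on_tendsto_compose[OF continuous_on_apply_bcontfun[of UNIV g]] by simp
    moreover have "((\<lambda>f. dist f g) \<longlongrightarrow> 0) (at g)"
      by (subst tendsto_dist_iff[symmetric]) (rule tendsto_ident_at)
    ultimately have lim: "((\<lambda>f. dist f g + dist (apply_bcontfun g (?y f)) (apply_bcontfun g (?y g))) \<longlongrightarrow> 0 + 0) (at g)"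
      by (intro tendsto_add) (simp_all add: tendsto_dist_iff[symmetric])
    have le: "dist (apply_bcontfun f (?y f)) (apply_bcontfun g (?y g)) \<le>
        dist f g + dist (apply_bcontfun g (?y f)) (apply_bcontfun g (?y g))" for f
      using dist_triangle[of "apply_bcontfun f (?y f)" "apply_bcontfun g (?y g)" "apply_bcontfun g (?y f)"]
        dist_bounded[of f "?y f" g] by simp
    show ?thesis
      unfolding tendsto_dist_iff[of "\<lambda>f. apply_bcontfun f (?y f)"]
      by (rule tendsto_sandwich[OF _ _ tendsto_const lim[simplified]]) (simp_all add: le always_eventually)
  qed
  then show ?case by (simp add: continuous_on_def)
qed simp

lemma measurable_empirical:
  assumes "n > 0" "continuous_on UNIV f" "sets \<mu> = sets borel"
  shows "empirical n f \<in> \<mu> \<rightarrow>\<^sub>M borel_of (weak_star euclidean)"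
proof -
  have "continuous_on UNIV (f ^^ i)" for i
    using assms(2) by (induction i) (auto intro: continuous_on_compose2 simp: o_def id_def)
  then have cont: "continuous_map euclidean (weak_star euclidean) (empirical n f)"
    using assms(1) continuous_map_empirical[of n euclidean "\<lambda>_. f" "\<lambda>x. x"] by simp
  show ?thesis
    unfolding borel_of_def
  proof (rule measurable_measure_of)
    show "{U. openin (weak_star euclidean) U} \<subseteq> Pow (topspace (weak_star euclidean))"
      using openin_subset by blast
    show "empirical n f \<in> space \<mu> \<rightarrow> topspace (weak_star euclidean)"
      using assms(1) by (simp add: empirical_in_prob_measures)
    fix U :: "'a measure set" assume "U \<in> {U. openin (weak_star euclidean) U}"
    then have "open (empirical n f -` U)"
      using openin_continuous_map_preimage[OF cont, of U] by (simp add: vimage_def)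
    then show "empirical n f -` U \<inter> space \<mu> \<in> sets \<mu>"
      using assms(3) sets_eq_imp_space_eq[OF assms(3)] by simp
  qed
qed

text \<open>
  Uniform convergence is used only through pointwise convergence of the empirical measures; for a
  bounded test function on measures dominated convergence over the starting point does the rest.
  Sequences suffice because the space of maps is metric.
\<close>

lemma continuous_map_empirical_law:
  fixes \<mu> :: "'a::metric_space measure"
  assumes "n > 0" "prob_space \<mu>" "sets \<mu> = sets borel"
  shows "continuous_map euclidean (weak_star (weak_star euclidean))
           (\<lambda>f :: 'a \<Rightarrow>\<^sub>C 'a. empirical_law \<mu> n (apply_bcontfun f))"
proof (rule continuous_map_into_weak_star)
  have meas: "empirical n (apply_bcontfun f) \<in> \<mu> \<rightarrow>\<^sub>M borel_of (weak_star euclidean)" for f :: "'a \<Rightarrow>\<^sub>C 'a"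
    using assms by (intro measurable_empirical) auto
  show "empirical_law \<mu> n (apply_bcontfun f) \<in> prob_measures (weak_star euclidean)" for f :: "'a \<Rightarrow>\<^sub>C 'a"
    using prob_space.prob_space_distr[OF assms(2) meas]
    by (simp add: prob_measures_def empirical_law_def)
  fix \<Phi> :: "'a measure \<Rightarrow> real"
  assume \<Phi>: "continuous_map (weak_star euclidean) euclideanreal \<Phi>" "bounded (\<Phi> ` topspace (weak_star euclidean))"
  have \<Phi>_meas: "\<Phi> \<in> borel_measurable (borel_of (weak_star euclidean))"
    using \<Phi>(1) by (rule borel_measurable_continuous_map) simp
  have eq: "(\<integral>\<nu>. \<Phi> \<nu> \<partial>empirical_law \<mu> n (apply_bcontfun f)) = (\<integral>x. \<Phi> (empirical n (apply_bcontfun f) x) \<partial>\<mu>)"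
    for f :: "'a \<Rightarrow>\<^sub>C 'a"
    unfolding empirical_law_def using meas \<Phi>_meas by (rule integral_distr)
  obtain b where b: "\<And>\<nu>. \<nu> \<in> prob_measures euclidean \<Longrightarrow> norm (\<Phi> \<nu>) \<le> b"
    using \<Phi>(2) by (auto simp: bounded_iff)
  interpret prob_space \<mu> by fact
  have "continuous_on UNIV (\<lambda>f :: 'a \<Rightarrow>\<^sub>C 'a. \<integral>x. \<Phi> (empirical n (apply_bcontfun f) x) \<partial>\<mu>)"
    unfolding continuous_on_sequentially comp_def
  proof (intro allI ballI impI)
    fix g :: "nat \<Rightarrow> 'a \<Rightarrow>\<^sub>C 'a" and f
    assume "(\<forall>k. g k \<in> UNIV) \<and> g \<longlonglongrightarrow> f"
    then have g: "g \<longlonglongrightarrow> f" by simp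
    show "(\<lambda>k. \<integral>x. \<Phi> (empirical n (apply_bcontfun (g k)) x) \<partial>\<mu>) \<longlonglongrightarrow>
        (\<integral>x. \<Phi> (empirical n (apply_bcontfun f) x) \<partial>\<mu>)"
    proof (rule integral_dominated_convergence[where w = "\<lambda>_. b"])
      show "(\<lambda>x. \<Phi> (empirical n (apply_bcontfun f) x)) \<in> borel_measurable \<mu>"
        using meas \<Phi>_meas by (rule measurable_compose)
      show "(\<lambda>x. \<Phi> (empirical n (apply_bcontfun (g k)) x)) \<in> borel_measurable \<mu>" for k
        using meas \<Phi>_meas by (rule measurable_compose)
      show "AE x in \<mu>. (\<lambda>k. \<Phi> (empirical n (apply_bcontfun (g k)) x)) \<longlonglongrightarrow> \<Phi> (empirical n (apply_bcontfun f) x)"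
      proof (rule AE_I2)
        fix x
        have "continuous_map euclidean (weak_star euclidean) (\<lambda>f :: 'a \<Rightarrow>\<^sub>C 'a. empirical n (apply_bcontfun f) x)"
          using assms(1) continuous_on_iterate_bcontfun by (intro continuous_map_empirical) auto
        from continuous_map_compose[OF this \<Phi>(1)]
        have "continuous_on UNIV (\<lambda>f :: 'a \<Rightarrow>\<^sub>C 'a. \<Phi> (empirical n (apply_bcontfun f) x))"
          by (simp add: o_def)
        then show "(\<lambda>k. \<Phi> (empirical n (apply_bcontfun (g k)) x)) \<longlonglongrightarrow> \<Phi> (empirical n (apply_bcontfun f) x)"
          using g by (rule continuous_on_tendsto_compose) auto
      qed
      show "AE x in \<mu>. norm (\<Phi> (empirical n (apply_bcontfun (g k)) x)) \<le> b" for k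
        using assms(1) by (intro AE_I2 b empirical_in_prob_measures) simp
    qed simp
  qed
  then show "continuous_map euclidean euclideanreal
      (\<lambda>f :: 'a \<Rightarrow>\<^sub>C 'a. \<integral>\<nu>. \<Phi> \<nu> \<partial>empirical_law \<mu> n (apply_bcontfun f))"
    by (simp add: eq)
qed

section \<open>The Baire category argument\<close>

lemma dense_open_union_exterior:
  assumes "openin L U"
  defines "E \<equiv> U \<union> (topspace L - L closure_of U)"
  shows "openin L E" "L closure_of E = topspace L"
proof -
  show "openin L E" unfolding E_def using assms(1) by (intro openin_Un openin_diff) auto
  have "U \<subseteq> L closure_of U" using assms(1) by (intro closure_of_subset openin_subset)
  moreover have "L closure_of U \<subseteq> L closure_of E" by (intro closure_of_mono) (simp add: E_def)
  moreover have "E \<subseteq> L closure_of E" using \<open>openin L E\<close> by (intro closure_of_subset openin_subset)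
  ultimately show "L closure_of E = topspace L"
    using closure_of_subset_topspace[of L E] by (auto simp: E_def)
qed

text \<open>
  Intersecting the first \<open>k\<close> members of a countable neighbourhood base gives shrinking
  neighbourhoods \<open>W k\<close>; increasing times of visits to \<open>W 0\<close>, \<open>W 1\<close>, \<dots> form the subsequence.
\<close>

lemma frequently_imp_mem_acc:
  assumes "first_countable T" "l \<in> topspace T"
    and freq: "\<And>U N. openin T U \<Longrightarrow> l \<in> U \<Longrightarrow> \<exists>n\<ge>N. s n \<in> U"
  shows "l \<in> acc T s"
proof -
  obtain \<B> where \<B>: "countable \<B>" "\<And>V. V \<in> \<B> \<Longrightarrow> openin T V"
    "\<And>U. openin T U \<Longrightarrow> l \<in> U \<Longrightarrow> \<exists>V\<in>\<B>. l \<in> V \<and> V \<subseteq> U"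
    using assms(1,2) unfolding first_countable_def by meson
  define \<N> where "\<N> = {V \<in> \<B>. l \<in> V}"
  have "\<N> \<noteq> {}" using \<B>(3)[OF openin_topspace assms(2)] by (auto simp: \<N>_def)
  moreover have "countable \<N>" using \<B>(1) by (simp add: \<N>_def)
  ultimately have range: "range (from_nat_into \<N>) = \<N>" by (rule range_from_nat_into)
  define W where "W k = (\<Inter>i\<le>k. from_nat_into \<N> i)" for k
  have V: "openin T (from_nat_into \<N> i)" "l \<in> from_nat_into \<N> i" for i
    using range \<B>(2) by (auto simp: \<N>_def)
  have W: "openin T (W k)" "l \<in> W k" for k
    unfolding W_def using V by (auto intro!: openin_INT)
  have "\<exists>r. \<forall>k. s (r k) \<in> W k \<and> r k < r (Suc k)"
  proof (rule dependent_nat_choice)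
    show "\<exists>n. s n \<in> W 0" using freq W by blast
    show "\<exists>m. s m \<in> W (Suc k) \<and> n < m" for n k
      using freq W by (meson Suc_le_lessD)
  qed
  then obtain r where r: "\<And>k. s (r k) \<in> W k" "\<And>k. r k < r (Suc k)" by auto
  have "limitin T (s \<circ> r) l sequentially"
    unfolding limitin_def
  proof (intro conjI allI impI)
    fix U assume "openin T U \<and> l \<in> U"
    then obtain V where "V \<in> \<N>" "V \<subseteq> U" using \<B>(3) by (auto simp: \<N>_def)
    then obtain i where "from_nat_into \<N> i \<subseteq> U" using range by (metis imageE)
    then have "(s \<circ> r) k \<in> U" if "k \<ge> i" for k using r(1)[of k] that by (auto simp: W_def)
    then show "eventually (\<lambda>k. (s \<circ> r) k \<in> U) sequentially" by (auto simp: eventually_sequentially)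
  qed fact
  then show "l \<in> acc T s" using r(2) by (auto simp: acc_def strict_mono_Suc_iff)
qed

text \<open>
  The statement is one about an arbitrary sequence of continuous maps: generically, limits along
  perturbed parameters are already limits along the unperturbed parameter.  Time \<open>0\<close> is excluded
  because the empirical measure of an empty orbit segment is not a probability measure.
\<close>

lemma generic_limits_eq_acc:
  fixes s :: "nat \<Rightarrow> 'b \<Rightarrow> 'c"
  assumes "second_countable Y" and cont: "\<And>n. n > 0 \<Longrightarrow> continuous_map L Y (s n)"
  shows "baire_generic L (\<lambda>f.
    {l. \<exists>g m. (\<forall>k. g k \<in> topspace L) \<and> limitin L g f sequentially \<and> filterlim m at_top sequentially \<and>
        limitin Y (\<lambda>k :: nat. s (m k) (g k)) l sequentially} = acc Y (\<lambda>n. s n f))"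
proof -
  obtain \<B> where \<B>: "countable \<B>" "\<And>V. V \<in> \<B> \<Longrightarrow> openin Y V"
    "\<And>U l. openin Y U \<Longrightarrow> l \<in> U \<Longrightarrow> \<exists>V\<in>\<B>. l \<in> V \<and> V \<subseteq> U"
    using assms(1) unfolding second_countable_def by meson
  \<comment> \<open>\<open>Suc N\<close> instead of \<open>N\<close> keeps the visiting times positive.\<close>
  define R where "R = (\<lambda>(V, N). {f \<in> topspace L. \<exists>n\<ge>Suc N. s n f \<in> V})"
  have R_open: "openin L (R (V, N))" if "V \<in> \<B>" for V N
  proof -
    have "R (V, N) = (\<Union>n\<in>{Suc N..}. {f \<in> topspace L. s n f \<in> V})" by (auto simp: R_def)
    then show ?thesis
      using openin_continuous_map_preimage[OF cont \<B>(2)[OF that]] by (auto intro!: openin_Union)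
  qed
  let ?E = "\<lambda>U. U \<union> (topspace L - L closure_of U)"
  have limits_eq: "{l. \<exists>g m. (\<forall>k. g k \<in> topspace L) \<and> limitin L g f sequentially \<and> filterlim m at_top sequentially \<and>
        limitin Y (\<lambda>k :: nat. s (m k) (g k)) l sequentially} = acc Y (\<lambda>n. s n f)" (is "?A = _")
    if f: "f \<in> topspace L \<inter> \<Inter> ((\<lambda>p. ?E (R p)) ` (\<B> \<times> UNIV))" for f
  proof (intro Set.equalityI subsetI)
    fix l assume "l \<in> acc Y (\<lambda>n. s n f)"
    then obtain r where r: "strict_mono r" "limitin Y (\<lambda>k. s (r k) f) l sequentially"
      by (auto simp: acc_def o_def)
    then show "l \<in> ?A"
      using f filterlim_subseq[OF r(1)] by (auto intro!: exI[of _ "\<lambda>_. f"] exI[of _ r])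
  next
    fix l assume "l \<in> ?A"
    then obtain g m where g: "\<And>k. g k \<in> topspace L" "limitin L g f sequentially"
      and m: "filterlim m at_top sequentially"
      and lim: "limitin Y (\<lambda>k :: nat. s (m k) (g k)) l sequentially" by blast
    have l: "l \<in> topspace Y" using lim by (simp add: limitin_def)
    have "\<exists>n\<ge>N. s n f \<in> U" if U: "openin Y U" "l \<in> U" for U N
    proof -
      obtain V where V: "V \<in> \<B>" "l \<in> V" "V \<subseteq> U" using \<B>(3) U by blast
      have "eventually (\<lambda>k. s (m k) (g k) \<in> V) sequentially"
        using lim V(2) \<B>(2)[OF V(1)] by (simp add: limitin_def)
      moreover have "eventually (\<lambda>k. m k \<ge> Suc N) sequentially"
        using m by (simp add: filterlim_at_top)
      ultimately have near: "eventually (\<lambda>k. g k \<in> R (V, N)) sequentially"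
        by eventually_elim (use g(1) in \<open>auto simp: R_def\<close>)
      have "f \<in> L closure_of R (V, N)"
        unfolding in_closure_of
      proof (intro conjI allI impI)
        show "f \<in> topspace L" using f by blast
        fix W assume "f \<in> W \<and> openin L W"
        then have "eventually (\<lambda>k. g k \<in> W) sequentially" using g(2) by (simp add: limitin_def)
        with near have "eventually (\<lambda>k. g k \<in> R (V, N) \<and> g k \<in> W) sequentially"
          by (rule eventually_conj)
        then show "\<exists>y. y \<in> R (V, N) \<and> y \<in> W"
          using eventually_happens'[OF sequentially_bot] by blast
      qed
      moreover have "f \<in> ?E (R (V, N))" using f V(1) by blast
      ultimately have "f \<in> R (V, N)" by blast
      then show ?thesis using V(3) by (auto simp: R_def intro: Suc_leD)
    qed
    then show "l \<in> acc Y (\<lambda>n. s n f)"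
      by (intro frequently_imp_mem_acc second_countable_imp_first_countable assms(1) l)
  qed
  show ?thesis
    unfolding baire_generic_def
  proof (intro exI[of _ "(\<lambda>p. ?E (R p)) ` (\<B> \<times> UNIV)"] conjI ballI)
    show "countable ((\<lambda>p. ?E (R p)) ` (\<B> \<times> UNIV))"
      using \<B>(1) by (intro countable_image countable_SIGMA) auto
    show "openin L E" "L closure_of E = topspace L" if "E \<in> (\<lambda>p. ?E (R p)) ` (\<B> \<times> UNIV)" for E
      using that dense_open_union_exterior[OF R_open] by blast+
  qed (rule limits_eq)
qed

theorem theoremE:
  fixes \<mu> :: "'a::metric_space measure"
    and \<Lambda> :: "('a \<Rightarrow>\<^sub>C 'a) set"
    and L :: "('a \<Rightarrow>\<^sub>C 'a) topology"
  assumes "compact (UNIV :: 'a set)"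
    and "prob_space \<mu>" and "sets \<mu> = sets borel"
    and "topspace L = \<Lambda>"
    and "\<And>U. openin (top_of_set \<Lambda>) U \<Longrightarrow> openin L U"
  shows "baire_generic L (\<lambda>f. bifurcation_set L \<mu> f =
           acc (weak_star (weak_star euclidean)) (\<lambda>n. empirical_law \<mu> n (apply_bcontfun f)))"
proof -
  obtain C :: "('a \<Rightarrow> real) set" where C: "cozero_base euclidean C" "countable C"
    using compact_imp_cozero_base[OF assms(1)] by blast
  obtain D :: "('a measure \<Rightarrow> real) set" where D: "cozero_base (weak_star euclidean) D" "countable D"
    using cozero_base_weak_star[OF C] by blast
  obtain E :: "('a measure measure \<Rightarrow> real) set"
    where E: "cozero_base (weak_star (weak_star euclidean)) E" "countable E"
    using cozero_base_weak_star[OF D] by blast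
  have "second_countable (weak_star (weak_star (euclidean :: 'a topology)))"
    using E by (rule cozero_base_imp_second_countable)
  moreover have "continuous_map L (weak_star (weak_star euclidean)) (\<lambda>f. empirical_law \<mu> n (apply_bcontfun f))"
    if "n > 0" for n
  proof -
    have "continuous_map (top_of_set \<Lambda>) (weak_star (weak_star euclidean)) (\<lambda>f. empirical_law \<mu> n (apply_bcontfun f))"
      using continuous_map_empirical_law[OF that assms(2,3)] by (rule continuous_map_from_subtopology)
    then show ?thesis using assms(4,5) by (simp add: continuous_map_def)
  qed
  ultimately show ?thesis
    unfolding bifurcation_set_def bifurcates_toward_def
    by (rule generic_limits_eq_acc[where s = "\<lambda>n f. empirical_law \<mu> n (apply_bcontfun f)"])
qed

end
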